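(* Let $\mathcal{K}$ be a class-locally presentable category, let $\lambda$ be a regular cardinal and let $\mathcal{C}$ be a cone-coreflective class of $\lambda$-presentable morphisms of $\mathcal{K}$. Then $\operatorname{Inj}(\mathcal{C})$ is weakly reflective and closed under $\lambda$-filtered colimits in $\mathcal{K}$.
   Context: Sets and classes are distinguished (Gödel–Bernays set theory); a category may have a proper class of objects but has hom-sets between any two objects. Limits and colimits are small. For a regular cardinal $\mu$, an object $K$ of $\mathcal{K}$ is $\mu$-presentable if $\hom(K,-):\mathcal{K}\to\mathbf{Set}$ preserves $\mu$-filtered colimits. $\mathcal{K}$ is class-$\mu$-accessible if it has $\mu$-filtered colimits and there is a class $\mathcal{A}$ of $\mu$-presentable objects such that every object of $\mathcal{K}$ is a $\mu$-filtered colimit of objects from $\mathcal{A}$. $\mathcal{K}$ is class-locally presentable if it is complete, cocomplete and class-$\mu$-accessible for some regular cardinal $\mu$. A morphism is $\lambda$-presentable if its domain and codomain are $\lambda$-presentable in $\mathcal{K}$. $\mathcal{K}^\to$ is the category of morphisms of $\mathcal{K}$ (morphisms are commutative squares). A class $\mathcal{C}$ of morphisms of $\mathcal{K}$ is cone-coreflective if for each morphism $f$ of $\mathcal{K}$ there is a subset (a set, not a proper class) $\mathcal{C}_f\subseteq\mathcal{C}$ such that each morphism $g\to f$ in $\mathcal{K}^\to$ with $g\in\mathcal{C}$ factorizes as $g\to h\to f$ in $\mathcal{K}^\to$ with $h\in\mathcal{C}_f$. $\operatorname{Inj}(\mathcal{C})$ is the full subcategory of $\mathcal{K}$ of objects $K$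 injective to each $h\in\mathcal{C}$: for every $h:C\to D$ in $\mathcal{C}$ and $u:C\to K$ there is $v:D\to K$ with $vh=u$. A full subcategory $\mathcal{L}$ of $\mathcal{K}$ is weakly reflective if for each object $K$ of $\mathcal{K}$ there is a morphism $r:K\to K^\ast$ with $K^\ast\in\mathcal{L}$ such that each morphism $K\to L$ with $L\in\mathcal{L}$ factorizes through $r$. *)

theory Defs
  imports Main "HOL-Library.FuncSet"
begin

unbundle cardinal_syntax

section \<open>Sets and classes\<close>

text \<open>
  Goedel--Bernays set theory is modelled over a type \<open>'v\<close> whose elements code the sets.
  Classes are the terms of type \<open>'v set\<close>; by limitation of size, a class is a set iff it is
  strictly smaller than the universal class. The predicate \<open>gb_universe\<close> states the
  axioms of infinity, of replacement and union, and of power set; equivalently, the cardinality of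
  \<open>'v\<close> is strongly inaccessible.
  Categories have elements of \<open>'v\<close> as objects and morphisms, so that their objects and
  morphisms may form proper classes.
\<close>

definition small :: "'v set \<Rightarrow> bool" where
  "small A \<longleftrightarrow> |A| <o |UNIV :: 'v set|"

definition gb_universe :: "'v itself \<Rightarrow> bool" where
  "gb_universe _ \<longleftrightarrow>
     natLeq <o |UNIV :: 'v set| \<and>
     regularCard |UNIV :: 'v set| \<and>
     (\<forall>A :: 'v set. small A \<longrightarrow> |Pow A| <o |UNIV :: 'v set| )"

text \<open>
  A cardinal is a cardinal-minimal well-order in the sense of the library. Since it is itself a set
  it must be smaller than the universe.
\<close>

definition regular_cardinal :: "'v rel \<Rightarrow> bool" where
  "regular_cardinal \<mu> \<longleftrightarrow>
     Card_order \<mu> \<and> cinfinite \<mu> \<and> regularCard \<mu> \<and> \<mu> <o |UNIV :: 'v set|"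


section \<open>Categories and functors\<close>

text \<open>\<open>Comp K g f\<close> is the composite of \<open>g\<close> after \<open>f\<close>. Outside \<open>Ob\<close> and \<open>Mor\<close> the operations
  are unconstrained.\<close>

record ('o, 'm) category_data =
  Ob :: "'o set"
  Mor :: "'m set"
  Dom :: "'m \<Rightarrow> 'o"
  Cod :: "'m \<Rightarrow> 'o"
  Ident :: "'o \<Rightarrow> 'm"
  Comp :: "'m \<Rightarrow> 'm \<Rightarrow> 'm"

definition hom :: "('o, 'm) category_data \<Rightarrow> 'o \<Rightarrow> 'o \<Rightarrow> 'm set" where
  "hom K a b = {f \<in> Mor K. Dom K f = a \<and> Cod K f = b}"

locale category =
  fixes K :: "('o, 'm) category_data"
  assumes dom_in_Ob: "f \<in> Mor K \<Longrightarrow> Dom K f \<in> Ob K"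
    and cod_in_Ob: "f \<in> Mor K \<Longrightarrow> Cod K f \<in> Ob K"
    and ident_in_hom: "a \<in> Ob K \<Longrightarrow> Ident K a \<in> hom K a a"
    and comp_in_hom: "f \<in> hom K a b \<Longrightarrow> g \<in> hom K b c \<Longrightarrow> Comp K g f \<in> hom K a c"
    and comp_ident_right: "f \<in> hom K a b \<Longrightarrow> Comp K f (Ident K a) = f"
    and comp_ident_left: "f \<in> hom K a b \<Longrightarrow> Comp K (Ident K b) f = f"
    and comp_assoc: "f \<in> hom K a b \<Longrightarrow> g \<in> hom K b c \<Longrightarrow> h \<in> hom K c d \<Longrightarrow>
      Comp K h (Comp K g f) = Comp K (Comp K h g) f"

locale locally_small_category = category K for K :: "('o, 'v) category_data" +
  assumes hom_small: "a \<in> Ob K \<Longrightarrow> b \<in> Ob K \<Longrightarrow> small (hom K a b)"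

definition small_category :: "('v, 'v) category_data \<Rightarrow> bool" where
  "small_category J \<longleftrightarrow> category J \<and> small (Ob J) \<and> small (Mor J)"

definition full_subcategory ::
  "('o, 'm) category_data \<Rightarrow> 'o set \<Rightarrow> ('o, 'm) category_data" where
  "full_subcategory K X =
     K\<lparr>Ob := Ob K \<inter> X, Mor := {f \<in> Mor K. Dom K f \<in> X \<and> Cod K f \<in> X}\<rparr>"

lemma (in category) category_full_subcategory: "category (full_subcategory K X)"
proof -
  have hom: "hom (full_subcategory K X) a b = (if a \<in> X \<and> b \<in> X then hom K a b else {})" for a b
    by (auto simp: hom_def full_subcategory_def)
  show ?thesis
    by unfold_locales
      (auto simp: hom, auto simp: full_subcategory_def split: if_splits
        intro: dom_in_Ob cod_in_Ob ident_in_hom comp_in_hom comp_ident_left comp_ident_right comp_assoc)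
qed

record ('o1, 'm1, 'o2, 'm2) functor_data =
  OMap :: "'o1 \<Rightarrow> 'o2"
  MMap :: "'m1 \<Rightarrow> 'm2"

definition is_functor ::
  "('o1, 'm1) category_data \<Rightarrow> ('o2, 'm2) category_data \<Rightarrow>
   ('o1, 'm1, 'o2, 'm2) functor_data \<Rightarrow> bool" where
  "is_functor J K F \<longleftrightarrow>
     (\<forall>a \<in> Ob J. OMap F a \<in> Ob K) \<and>
     (\<forall>f \<in> Mor J. MMap F f \<in> hom K (OMap F (Dom J f)) (OMap F (Cod J f))) \<and>
     (\<forall>a \<in> Ob J. MMap F (Ident J a) = Ident K (OMap F a)) \<and>
     (\<forall>f \<in> Mor J. \<forall>g \<in> Mor J. Cod J f = Dom J g \<longrightarrow>
        MMap F (Comp J g f) = Comp K (MMap F g) (MMap F f))"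

definition functor_comp ::
  "('o2, 'm2, 'o3, 'm3) functor_data \<Rightarrow> ('o1, 'm1, 'o2, 'm2) functor_data \<Rightarrow>
   ('o1, 'm1, 'o3, 'm3) functor_data" where
  "functor_comp G F = \<lparr>OMap = OMap G \<circ> OMap F, MMap = MMap G \<circ> MMap F\<rparr>"


section \<open>Limits and colimits\<close>

definition is_cocone ::
  "('i, 'n) category_data \<Rightarrow> ('o, 'm) category_data \<Rightarrow> ('i, 'n, 'o, 'm) functor_data \<Rightarrow>
   'o \<Rightarrow> ('i \<Rightarrow> 'm) \<Rightarrow> bool" where
  "is_cocone J K D c \<iota> \<longleftrightarrow>
     c \<in> Ob K \<and>
     (\<forall>j \<in> Ob J. \<iota> j \<in> hom K (OMap D j) c) \<and>
     (\<forall>f \<in> Mor J. Comp K (\<iota> (Cod J f)) (MMap D f) = \<iota> (Dom J f))"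

definition is_colimit ::
  "('i, 'n) category_data \<Rightarrow> ('o, 'm) category_data \<Rightarrow> ('i, 'n, 'o, 'm) functor_data \<Rightarrow>
   'o \<Rightarrow> ('i \<Rightarrow> 'm) \<Rightarrow> bool" where
  "is_colimit J K D c \<iota> \<longleftrightarrow>
     is_cocone J K D c \<iota> \<and>
     (\<forall>c' \<iota>'. is_cocone J K D c' \<iota>' \<longrightarrow>
        (\<exists>!u. u \<in> hom K c c' \<and> (\<forall>j \<in> Ob J. Comp K u (\<iota> j) = \<iota>' j)))"

definition is_cone ::
  "('i, 'n) category_data \<Rightarrow> ('o, 'm) category_data \<Rightarrow> ('i, 'n, 'o, 'm) functor_data \<Rightarrow>
   'o \<Rightarrow> ('i \<Rightarrow> 'm) \<Rightarrow> bool" where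
  "is_cone J K D c \<pi> \<longleftrightarrow>
     c \<in> Ob K \<and>
     (\<forall>j \<in> Ob J. \<pi> j \<in> hom K c (OMap D j)) \<and>
     (\<forall>f \<in> Mor J. Comp K (MMap D f) (\<pi> (Dom J f)) = \<pi> (Cod J f))"

definition is_limit ::
  "('i, 'n) category_data \<Rightarrow> ('o, 'm) category_data \<Rightarrow> ('i, 'n, 'o, 'm) functor_data \<Rightarrow>
   'o \<Rightarrow> ('i \<Rightarrow> 'm) \<Rightarrow> bool" where
  "is_limit J K D c \<pi> \<longleftrightarrow>
     is_cone J K D c \<pi> \<and>
     (\<forall>c' \<pi>'. is_cone J K D c' \<pi>' \<longrightarrow>
        (\<exists>!u. u \<in> hom K c' c \<and> (\<forall>j \<in> Ob J. Comp K (\<pi> j) u = \<pi>' j)))"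

definition complete :: "('v, 'v) category_data \<Rightarrow> bool" where
  "complete K \<longleftrightarrow>
     (\<forall>(J :: ('v, 'v) category_data) D. small_category J \<and> is_functor J K D \<longrightarrow>
        (\<exists>c \<pi>. is_limit J K D c \<pi>))"

definition cocomplete :: "('v, 'v) category_data \<Rightarrow> bool" where
  "cocomplete K \<longleftrightarrow>
     (\<forall>(J :: ('v, 'v) category_data) D. small_category J \<and> is_functor J K D \<longrightarrow>
        (\<exists>c \<iota>. is_colimit J K D c \<iota>))"

text \<open>
  A category is \<open>\<mu>\<close>-filtered if every diagram in it with fewer than \<open>\<mu>\<close> morphisms has a cocone.
  (Asking this only for subcategories would be too weak for \<open>\<mu> = \<aleph>\<^sub>0\<close>: the additive monoid of
  natural numbers has just one finite subcategory with an object.)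
\<close>

definition filtered :: "'v rel \<Rightarrow> ('v, 'v) category_data \<Rightarrow> bool" where
  "filtered \<mu> J \<longleftrightarrow>
     category J \<and>
     (\<forall>(I :: ('v, 'v) category_data) D. category I \<and> |Mor I| <o \<mu> \<and> is_functor I J D \<longrightarrow>
        (\<exists>c \<iota>. is_cocone I J D c \<iota>))"

definition has_filtered_colimits :: "'v rel \<Rightarrow> ('v, 'v) category_data \<Rightarrow> bool" where
  "has_filtered_colimits \<mu> K \<longleftrightarrow>
     (\<forall>(J :: ('v, 'v) category_data) D.
        small_category J \<and> filtered \<mu> J \<and> is_functor J K D \<longrightarrow> (\<exists>c \<iota>. is_colimit J K D c \<iota>))"

definition preserves_filtered_colimits ::
  "'v rel \<Rightarrow> ('o1, 'm1) category_data \<Rightarrow> ('o2, 'm2) category_data \<Rightarrow>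
   ('o1, 'm1, 'o2, 'm2) functor_data \<Rightarrow> bool" where
  "preserves_filtered_colimits \<mu> K L F \<longleftrightarrow>
     (\<forall>(J :: ('v, 'v) category_data) D c \<iota>.
        small_category J \<and> filtered \<mu> J \<and> is_functor J K D \<and> is_colimit J K D c \<iota> \<longrightarrow>
        is_colimit J L (functor_comp F D) (OMap F c) (\<lambda>j. MMap F (\<iota> j)))"


section \<open>The category of sets and hom-functors\<close>

text \<open>
  Morphisms \<open>A \<rightarrow> B\<close> are triples \<open>(A, f, B)\<close>, where \<open>f\<close> is \<open>undefined\<close> outside \<open>A\<close> so that
  equality of morphisms is equality of functions on \<open>A\<close>.
\<close>

definition set_cat :: "('v set, 'v set \<times> ('v \<Rightarrow> 'v) \<times> 'v set) category_data" where
  "set_cat =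
     \<lparr>Ob = {A. small A},
      Mor = {(A, f, B). small A \<and> small B \<and> f \<in> A \<rightarrow>\<^sub>E B},
      Dom = (\<lambda>(A, f, B). A),
      Cod = (\<lambda>(A, f, B). B),
      Ident = (\<lambda>A. (A, \<lambda>x\<in>A. x, A)),
      Comp = (\<lambda>(B, g, C) (A, f, B'). (A, compose A g f, C))\<rparr>"

definition hom_functor ::
  "('o, 'v) category_data \<Rightarrow> 'o \<Rightarrow>
   ('o, 'v, 'v set, 'v set \<times> ('v \<Rightarrow> 'v) \<times> 'v set) functor_data" where
  "hom_functor K a =
     \<lparr>OMap = (\<lambda>b. hom K a b),
      MMap = (\<lambda>f. (hom K a (Dom K f), \<lambda>g\<in>hom K a (Dom K f). Comp K f g, hom K a (Cod K f)))\<rparr>"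

lemma category_set_cat: "category set_cat"
proof
qed (auto simp: set_cat_def hom_def compose_def PiE_iff extensional_def fun_eq_iff, metis)

lemma (in locally_small_category) is_functor_hom_functor:
  assumes "a \<in> Ob K"
  shows "is_functor K set_cat (hom_functor K a)"
proof -
  have small_hom: "small (hom K a (Dom K f))" "small (hom K a (Cod K f))" if "f \<in> Mor K" for f
    using that assms by (auto intro!: hom_small dom_in_Ob cod_in_Ob)
  have comp: "Comp K f g \<in> hom K a (Cod K f)" if "f \<in> Mor K" "g \<in> hom K a (Dom K f)" for f g
    using comp_in_hom[OF that(2), of f "Cod K f"] that(1) by (auto simp: hom_def)
  have "Dom K (Comp K g f) = Dom K f \<and> Cod K (Comp K g f) = Cod K g"
    if "f \<in> Mor K" "g \<in> Mor K" "Cod K f = Dom K g" for f g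
    using comp_in_hom[of f "Dom K f" "Cod K f" g "Cod K g"] that by (auto simp: hom_def)
  moreover have "Comp K (Comp K g f) h = Comp K g (Comp K f h)"
    if "f \<in> Mor K" "g \<in> Mor K" "Cod K f = Dom K g" "h \<in> hom K a (Dom K f)" for f g h
    using comp_assoc[OF that(4), of f "Cod K f" g "Cod K g"] that by (auto simp: hom_def)
  moreover have "Dom K (Ident K b) = b \<and> Cod K (Ident K b) = b" if "b \<in> Ob K" for b
    using ident_in_hom[OF that] by (auto simp: hom_def)
  moreover have "OMap (hom_functor K a) b \<in> Ob set_cat" if "b \<in> Ob K" for b
    using hom_small[OF assms that] by (simp add: set_cat_def hom_functor_def)
  moreover have "MMap (hom_functor K a) f
      \<in> hom set_cat (OMap (hom_functor K a) (Dom K f)) (OMap (hom_functor K a) (Cod K f))"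
    if "f \<in> Mor K" for f
    unfolding hom_def[of set_cat] using small_hom[OF that] comp[OF that]
    by (auto simp: set_cat_def hom_functor_def)
  ultimately show ?thesis
    using comp_ident_left[of _ a] comp
    by (fastforce simp: is_functor_def set_cat_def hom_functor_def compose_def fun_eq_iff)
qed


section \<open>Class-locally presentable categories\<close>

definition presentable :: "'v rel \<Rightarrow> ('v, 'v) category_data \<Rightarrow> 'v \<Rightarrow> bool" where
  "presentable \<mu> K a \<longleftrightarrow>
     a \<in> Ob K \<and> preserves_filtered_colimits \<mu> K set_cat (hom_functor K a)"

definition presentable_morphism :: "'v rel \<Rightarrow> ('v, 'v) category_data \<Rightarrow> 'v \<Rightarrow> bool" where
  "presentable_morphism \<mu> K f \<longleftrightarrow>
     f \<in> Mor K \<and> presentable \<mu> K (Dom K f) \<and> presentable \<mu> K (Cod K f)"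

definition class_accessible :: "'v rel \<Rightarrow> ('v, 'v) category_data \<Rightarrow> bool" where
  "class_accessible \<mu> K \<longleftrightarrow>
     has_filtered_colimits \<mu> K \<and>
     (\<exists>\<A>. (\<forall>a \<in> \<A>. presentable \<mu> K a) \<and>
        (\<forall>x \<in> Ob K. \<exists>(J :: ('v, 'v) category_data) D \<iota>.
           small_category J \<and> filtered \<mu> J \<and> is_functor J K D \<and>
           (\<forall>j \<in> Ob J. OMap D j \<in> \<A>) \<and> is_colimit J K D x \<iota>))"

definition class_locally_presentable :: "('v, 'v) category_data \<Rightarrow> bool" where
  "class_locally_presentable K \<longleftrightarrow>
     locally_small_category K \<and> complete K \<and> cocomplete K \<and>
     (\<exists>\<mu>. regular_cardinal \<mu> \<and> class_accessible \<mu> K)"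


section \<open>Cone-coreflective classes of morphisms\<close>

text \<open>A morphism from \<open>f\<close> to \<open>g\<close> in the arrow category is \<open>(f, u, v, g)\<close> where \<open>u\<close> and \<open>v\<close> are
  the components on the domains and on the codomains.\<close>

definition arrow_cat :: "('o, 'm) category_data \<Rightarrow> ('m, 'm \<times> 'm \<times> 'm \<times> 'm) category_data" where
  "arrow_cat K =
     \<lparr>Ob = Mor K,
      Mor = {(f, u, v, g). f \<in> Mor K \<and> g \<in> Mor K \<and>
        u \<in> hom K (Dom K f) (Dom K g) \<and> v \<in> hom K (Cod K f) (Cod K g) \<and>
        Comp K v f = Comp K g u},
      Dom = (\<lambda>(f, u, v, g). f),
      Cod = (\<lambda>(f, u, v, g). g),
      Ident = (\<lambda>f. (f, Ident K (Dom K f), Ident K (Cod K f), f)),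
      Comp = (\<lambda>(g, u', v', h) (f, u, v, g'). (f, Comp K u' u, Comp K v' v, h))\<rparr>"

lemma arrow_cat_simps:
  "Ob (arrow_cat K) = Mor K"
  "Dom (arrow_cat K) (f, u, v, g) = f"
  "Cod (arrow_cat K) (f, u, v, g) = g"
  "Ident (arrow_cat K) f = (f, Ident K (Dom K f), Ident K (Cod K f), f)"
  "Comp (arrow_cat K) (g, u', v', h) (f, u, v, g') = (f, Comp K u' u, Comp K v' v, h)"
  by (simp_all add: arrow_cat_def)

lemma hom_arrow_cat:
  "s \<in> hom (arrow_cat K) f g \<longleftrightarrow>
     (\<exists>u v. s = (f, u, v, g) \<and> f \<in> Mor K \<and> g \<in> Mor K \<and>
        u \<in> hom K (Dom K f) (Dom K g) \<and> v \<in> hom K (Cod K f) (Cod K g) \<and>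
        Comp K v f = Comp K g u)"
  unfolding hom_def[of "arrow_cat K"] by (auto simp: arrow_cat_def)

lemma (in category) category_arrow_cat: "category (arrow_cat K)"
proof -
  have ident: "Comp K (Ident K (Cod K f)) f = Comp K f (Ident K (Dom K f))" if "f \<in> Mor K" for f
    using that comp_ident_left[of f] comp_ident_right[of f] by (auto simp: hom_def)
  have paste: "Comp K (Comp K v' v) f = Comp K h (Comp K u' u)"
    if "f \<in> Mor K" "g \<in> Mor K" "h \<in> Mor K"
      "u \<in> hom K (Dom K f) (Dom K g)" "v \<in> hom K (Cod K f) (Cod K g)"
      "u' \<in> hom K (Dom K g) (Dom K h)" "v' \<in> hom K (Cod K g) (Cod K h)"
      "Comp K v f = Comp K g u" "Comp K v' g = Comp K h u'" for f g h u v u' v'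
  proof -
    have fgh: "f \<in> hom K (Dom K f) (Cod K f)" "g \<in> hom K (Dom K g) (Cod K g)"
      "h \<in> hom K (Dom K h) (Cod K h)" using that by (auto simp: hom_def)
    have "Comp K (Comp K v' v) f = Comp K v' (Comp K g u)"
      using comp_assoc[OF fgh(1) that(5) that(7)] that(8) by simp
    also have "\<dots> = Comp K (Comp K h u') u"
      using comp_assoc[OF that(4) fgh(2) that(7)] that(9) by simp
    also have "\<dots> = Comp K h (Comp K u' u)"
      using comp_assoc[OF that(4) that(6) fgh(3)] by simp
    finally show ?thesis .
  qed
  show ?thesis
  proof
    fix f assume "f \<in> Ob (arrow_cat K)"
    then show "Ident (arrow_cat K) f \<in> hom (arrow_cat K) f f"
      using ident[of f] ident_in_hom dom_in_Ob cod_in_Ob by (auto simp: arrow_cat_simps hom_arrow_cat)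
  next
    fix s t f g h assume "s \<in> hom (arrow_cat K) f g" "t \<in> hom (arrow_cat K) g h"
    then show "Comp (arrow_cat K) t s \<in> hom (arrow_cat K) f h"
      using paste by (fastforce simp: arrow_cat_simps hom_arrow_cat intro: comp_in_hom)
  next
    fix s assume "s \<in> Mor (arrow_cat K)"
    then show "Dom (arrow_cat K) s \<in> Ob (arrow_cat K)" "Cod (arrow_cat K) s \<in> Ob (arrow_cat K)"
      by (auto simp: arrow_cat_def)
  qed (auto simp: hom_arrow_cat arrow_cat_simps
      intro: comp_ident_left comp_ident_right comp_assoc)
qed

definition cone_coreflective :: "('v, 'v) category_data \<Rightarrow> 'v set \<Rightarrow> bool" where
  "cone_coreflective K \<C> \<longleftrightarrow>
     \<C> \<subseteq> Mor K \<and>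
     (\<forall>f \<in> Mor K. \<exists>\<C>\<^sub>f. \<C>\<^sub>f \<subseteq> \<C> \<and> small \<C>\<^sub>f \<and>
        (\<forall>g \<in> \<C>. \<forall>s \<in> hom (arrow_cat K) g f.
           \<exists>h \<in> \<C>\<^sub>f. \<exists>p \<in> hom (arrow_cat K) g h. \<exists>q \<in> hom (arrow_cat K) h f.
             s = Comp (arrow_cat K) q p))"


section \<open>Injectivity and weak reflectivity\<close>

definition injective_object :: "('o, 'm) category_data \<Rightarrow> 'm set \<Rightarrow> 'o \<Rightarrow> bool" where
  "injective_object K \<C> x \<longleftrightarrow>
     x \<in> Ob K \<and>
     (\<forall>h \<in> \<C>. \<forall>u \<in> hom K (Dom K h) x. \<exists>v \<in> hom K (Cod K h) x. Comp K v h = u)"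

definition Inj :: "('o, 'm) category_data \<Rightarrow> 'm set \<Rightarrow> ('o, 'm) category_data" where
  "Inj K \<C> = full_subcategory K {x. injective_object K \<C> x}"

definition weakly_reflective ::
  "('o, 'm) category_data \<Rightarrow> ('o, 'm) category_data \<Rightarrow> bool" where
  "weakly_reflective K L \<longleftrightarrow>
     (\<forall>x \<in> Ob K. \<exists>x' \<in> Ob L. \<exists>r \<in> hom K x x'.
        \<forall>y \<in> Ob L. \<forall>f \<in> hom K x y. \<exists>g \<in> hom K x' y. f = Comp K g r)"

text \<open>The colimit is formed in \<open>K\<close>, of a diagram that lies in the subcategory \<open>L\<close>.\<close>

definition closed_under_filtered_colimits ::
  "'v rel \<Rightarrow> ('v, 'v) category_data \<Rightarrow> ('v, 'v) category_data \<Rightarrow> bool" where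
  "closed_under_filtered_colimits \<mu> K L \<longleftrightarrow>
     (\<forall>(J :: ('v, 'v) category_data) D c \<iota>.
        small_category J \<and> filtered \<mu> J \<and> is_functor J L D \<and> is_colimit J K D c \<iota> \<longrightarrow>
        c \<in> Ob L)"

end

theory Submission
  imports Defs
begin

text \<open>
  Closure under filtered colimits comes from presentability of the domains: a map from
  \<open>Dom g\<close> into a \<open>\<kappa>\<close>-filtered colimit factors through some stage of the diagram
  (\<open>presentable_factors_through_stage\<close>), and if that stage is injective the extension found there
  can be composed with the colimit injection.

  Weak reflections come from a small object argument. The obstacle is that \<open>\<C>\<close> may be a proper
  class, so that one cannot attach solutions of all extension problems with values in a given
  object \<open>y\<close>. Cone-coreflectivity removes it. A map \<open>Dom g \<rightarrow> y\<close> is the same as a square from \<open>g\<close>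
  to the map \<open>y \<rightarrow> 1\<close> into the terminal object; all these squares factor through a set \<open>H \<subseteq> \<C>\<close>, and
  solving a problem for \<open>h \<in> H\<close> solves every problem that factors through it. As hom-classes are
  sets, the problems \<open>Dom h \<rightarrow> y\<close> with \<open>h \<in> H\<close> form a set, and one small colimit gives
  \<open>t : y \<rightarrow> y'\<close> in which all extension problems of \<open>y\<close> are solved
  (\<open>step_into_injectives\<close>). Every map from \<open>y\<close> to an injective object extends along \<open>t\<close>.

  This step is iterated along the well-order \<open>\<kappa>\<close>: the stage at \<open>i\<close> arises by applying the step to the
  colimit of all earlier stages, and the first stage is the given object \<open>x\<close>
  (\<open>small_object_chain_exists\<close>). Since \<open>\<kappa>\<close> is regular, it is \<open>\<kappa>\<close>-filtered as a category
  (\<open>filtered_thin_cat\<close>), so a map from \<open>Dom g\<close> into the colimit \<open>c\<close> of the chain factors through a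
  stage and is extended at a later one; hence \<open>c\<close> is injective. A map from \<open>x\<close> to an injective
  object extends over all stages compatibly, by a second transfinite recursion
  (\<open>extension_along_chain\<close>), and therefore over \<open>c\<close>.
\<close>


section \<open>Small sets\<close>

lemma gb_Cinfinite:
  assumes "gb_universe TYPE('v)"
  shows "Cinfinite |UNIV :: 'v set|" "regularCard |UNIV :: 'v set|" "infinite (UNIV :: 'v set)"
proof -
  have "natLeq \<le>o |UNIV :: 'v set|" "regularCard |UNIV :: 'v set|"
    using assms by (auto simp: gb_universe_def ordLess_imp_ordLeq)
  then show "Cinfinite |UNIV :: 'v set|" "regularCard |UNIV :: 'v set|" "infinite (UNIV :: 'v set)"
    using infinite_iff_natLeq_ordLeq[of "UNIV :: 'v set"]
    by (auto simp: cinfinite_def Field_card_of card_of_card_order_on)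
qed

lemma small_UN:
  assumes "gb_universe TYPE('v)" and "|A| <o |UNIV :: 'v set|"
    and "\<And>a. a \<in> A \<Longrightarrow> |F a| <o |UNIV :: 'v set|"
  shows "|\<Union>a\<in>A. F a| <o |UNIV :: 'v set|"
  using card_of_UNION_ordLess_infinite_Field_regularCard[of "|UNIV :: 'v set|" A F]
    gb_Cinfinite[OF assms(1)] assms(2,3) by blast

lemma small_image: "|A| <o r \<Longrightarrow> |f ` A| <o r"
  using card_of_image ordLeq_ordLess_trans by blast

lemma small_subset: "|B| <o r \<Longrightarrow> A \<subseteq> B \<Longrightarrow> |A| <o r"
  using card_of_mono1 ordLeq_ordLess_trans by blast

lemma small_finite:
  assumes "gb_universe TYPE('v)" and "finite A"
  shows "|A| <o |UNIV :: 'v set|"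
  using assms(2) gb_Cinfinite(3)[OF assms(1)]
  by (intro finite_ordLess_infinite) (auto simp: Field_card_of card_of_well_order_on)

lemma small_Un:
  assumes "gb_universe TYPE('v)" and "|A| <o |UNIV :: 'v set|" and "|B| <o |UNIV :: 'v set|"
  shows "|A \<union> B| <o |UNIV :: 'v set|"
  using card_of_Un_ordLess_infinite[OF gb_Cinfinite(3)] assms by blast

lemma small_Sigma:
  assumes "gb_universe TYPE('v)" and "|A| <o |UNIV :: 'v set|"
    and "\<And>a. a \<in> A \<Longrightarrow> |F a| <o |UNIV :: 'v set|"
  shows "|Sigma A F| <o |UNIV :: 'v set|"
proof -
  have "Sigma A F = (\<Union>a\<in>A. Pair a ` F a)"
    by auto
  moreover have "|\<Union>a\<in>A. Pair a ` F a| <o |UNIV :: 'v set|"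
    by (rule small_UN[OF assms(1,2)], rule small_image, rule assms(3))
  ultimately show ?thesis
    by simp
qed


section \<open>Diagrams over preorders\<close>

definition pair_code :: "'v \<times> 'v \<Rightarrow> 'v" where
  "pair_code = (SOME e. inj e)"

lemma inj_pair_code:
  assumes "gb_universe TYPE('v)"
  shows "inj (pair_code :: 'v \<times> 'v \<Rightarrow> 'v)"
proof -
  have "|UNIV \<times> UNIV :: ('v \<times> 'v) set| \<le>o |UNIV :: 'v set|"
    using card_of_Times_same_infinite[OF gb_Cinfinite(3)[OF assms]] ordIso_imp_ordLeq by blast
  then have "\<exists>e :: 'v \<times> 'v \<Rightarrow> 'v. inj e"
    unfolding card_of_ordLeq[symmetric] by auto
  then show ?thesis
    unfolding pair_code_def by (rule someI_ex)
qed

text \<open>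
  The preorder \<open>R\<close> as a category. Small categories have their morphisms in \<open>'v\<close>, so the only morphism
  from \<open>a\<close> to \<open>b\<close> is a code of the pair \<open>(a, b)\<close>.
\<close>

definition thin_cat :: "'v rel \<Rightarrow> ('v, 'v) category_data" where
  "thin_cat R =
     \<lparr>Ob = Field R,
      Mor = pair_code ` R,
      Dom = (\<lambda>f. fst (inv pair_code f)),
      Cod = (\<lambda>f. snd (inv pair_code f)),
      Ident = (\<lambda>a. pair_code (a, a)),
      Comp = (\<lambda>g f. pair_code (fst (inv pair_code f), snd (inv pair_code g)))\<rparr>"

lemma thin_cat_simps:
  fixes R :: "'v rel"
  assumes "gb_universe TYPE('v)"
  shows "Ob (thin_cat R) = Field R"
    and "Mor (thin_cat R) = pair_code ` R"
    and "Dom (thin_cat R) (pair_code (a, b)) = a"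
    and "Cod (thin_cat R) (pair_code (a, b)) = b"
    and "Ident (thin_cat R) a = pair_code (a, a)"
    and "Comp (thin_cat R) (pair_code (c, d)) (pair_code (a, b)) = pair_code (a, d)"
    and "f \<in> hom (thin_cat R) a b \<longleftrightarrow> f = pair_code (a, b) \<and> (a, b) \<in> R"
  using inj_pair_code[OF assms] by (auto simp: thin_cat_def hom_def)

lemma category_thin_cat:
  fixes R :: "'v rel"
  assumes gb: "gb_universe TYPE('v)" and "Refl R" "trans R"
  shows "category (thin_cat R)"
proof -
  have "(a, a) \<in> R" if "a \<in> Field R" for a
    using that assms(2) by (auto simp: refl_on_def)
  then show ?thesis
    by unfold_locales
      (auto simp: thin_cat_simps[OF gb] intro: FieldI1 FieldI2 transD[OF assms(3)])
qed

lemma small_category_thin_cat: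
  fixes R :: "'v rel"
  assumes gb: "gb_universe TYPE('v)" and "Refl R" "trans R" and "small (Field R)"
  shows "small_category (thin_cat R)"
proof -
  have "|Field R \<times> Field R| <o |UNIV :: 'v set|"
    using assms(4) by (intro small_Sigma[OF gb]) (auto simp: small_def)
  then have "|R| <o |UNIV :: 'v set|"
    by (rule small_subset) (auto dest: FieldI1 FieldI2)
  then show ?thesis
    using assms category_thin_cat[OF gb] small_image
    by (auto simp: small_category_def small_def thin_cat_simps[OF gb])
qed

text \<open>
  Diagrams over a preorder and their cocones, without a coding of the morphisms of the index category:
  the index type is arbitrary, so that diagrams can be indexed by whatever is convenient.
\<close>

definition thin_diagram ::
  "('o, 'm) category_data \<Rightarrow> 'i rel \<Rightarrow> ('i \<Rightarrow> 'o) \<Rightarrow> ('i \<Rightarrow> 'i \<Rightarrow> 'm) \<Rightarrow> bool" where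
  "thin_diagram K R X m \<longleftrightarrow>
     (\<forall>i \<in> Field R. X i \<in> Ob K \<and> m i i = Ident K (X i)) \<and>
     (\<forall>i j. (i, j) \<in> R \<longrightarrow> m i j \<in> hom K (X i) (X j)) \<and>
     (\<forall>i j k. (i, j) \<in> R \<longrightarrow> (j, k) \<in> R \<longrightarrow> Comp K (m j k) (m i j) = m i k)"

definition thin_cocone ::
  "('o, 'm) category_data \<Rightarrow> 'i rel \<Rightarrow> ('i \<Rightarrow> 'o) \<Rightarrow> ('i \<Rightarrow> 'i \<Rightarrow> 'm) \<Rightarrow>
   'o \<Rightarrow> ('i \<Rightarrow> 'm) \<Rightarrow> bool" where
  "thin_cocone K R X m c \<iota> \<longleftrightarrow>
     c \<in> Ob K \<and> (\<forall>i \<in> Field R. \<iota> i \<in> hom K (X i) c) \<and>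
     (\<forall>i j. (i, j) \<in> R \<longrightarrow> Comp K (\<iota> j) (m i j) = \<iota> i)"

definition thin_functor ::
  "('v \<Rightarrow> 'o) \<Rightarrow> ('v \<Rightarrow> 'v \<Rightarrow> 'm) \<Rightarrow> ('v, 'v, 'o, 'm) functor_data" where
  "thin_functor X m =
     \<lparr>OMap = X, MMap = (\<lambda>f. m (fst (inv pair_code f)) (snd (inv pair_code f)))\<rparr>"

lemma thin_functor_simps:
  assumes "gb_universe TYPE('v)"
  shows "OMap (thin_functor X m) = X"
    and "MMap (thin_functor X m) (pair_code (i :: 'v, j)) = m i j"
  using inj_pair_code[OF assms] by (auto simp: thin_functor_def)

lemma is_functor_thin_functor:
  fixes R :: "'v rel"
  assumes gb: "gb_universe TYPE('v)" and "thin_diagram K R X m"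
  shows "is_functor (thin_cat R) K (thin_functor X m)"
  using assms(2)
  by (auto simp: is_functor_def thin_diagram_def thin_cat_simps[OF gb] thin_functor_simps[OF gb])

lemma is_cocone_thin_functor:
  fixes R :: "'v rel"
  assumes gb: "gb_universe TYPE('v)"
  shows "is_cocone (thin_cat R) K (thin_functor X m) c \<iota> \<longleftrightarrow> thin_cocone K R X m c \<iota>"
  by (auto simp: is_cocone_def thin_cocone_def thin_cat_simps[OF gb] thin_functor_simps[OF gb])

locale cocomplete_category = locally_small_category K
  for K :: "('v, 'v) category_data" +
  assumes gb: "gb_universe TYPE('v)"
    and cocomplete: "cocomplete K"
begin

lemma thin_diagram_is_colimit:
  fixes R :: "'v rel"
  assumes "thin_diagram K R X m" and "Refl R" "trans R" and "small (Field R)"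
  obtains c \<iota> where "is_colimit (thin_cat R) K (thin_functor X m) c \<iota>"
  using cocomplete is_functor_thin_functor[OF gb assms(1)]
    small_category_thin_cat[OF gb assms(2,3,4)]
  unfolding cocomplete_def by blast

text \<open>
  Cocompleteness speaks of diagrams indexed by elements of \<open>'v\<close>. An index set of any other type that
  is smaller than \<open>'v\<close> embeds into \<open>'v\<close>, and the preorder is transported along the embedding.
\<close>

lemma thin_diagram_colimit:
  fixes R :: "'i rel"
  assumes diagram: "thin_diagram K R X m" and R: "Refl R" "trans R"
    and small: "|Field R| <o |UNIV :: 'v set|"
  obtains c \<iota> where "thin_cocone K R X m c \<iota>"
    and "\<And>c' \<iota>'. thin_cocone K R X m c' \<iota>' \<Longrightarrow>
      \<exists>u \<in> hom K c c'. \<forall>i \<in> Field R. Comp K u (\<iota> i) = \<iota>' i"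
proof -
  obtain e :: "'i \<Rightarrow> 'v" where e: "inj_on e (Field R)"
    using ordLess_imp_ordLeq[OF small] unfolding card_of_ordLeq[symmetric] by auto
  define d where "d = inv_into (Field R) e"
  have d: "d (e i) = i" if "i \<in> Field R" for i
    using e that by (simp add: d_def)
  define R' where "R' = map_prod e e ` R"
  have R'I: "(e i, e j) \<in> R'" if "(i, j) \<in> R" for i j
    using that by (auto simp: R'_def intro!: rev_image_eqI)
  have inField: "i \<in> Field R" "j \<in> Field R" if "(i, j) \<in> R" for i j
    using that by (rule FieldI1 FieldI2)+
  have R'E: "a \<in> e ` Field R \<and> b \<in> e ` Field R \<and> (d a, d b) \<in> R" if "(a, b) \<in> R'" for a b
  proof -
    from that obtain i j where "(i, j) \<in> R" "a = e i" "b = e j"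
      by (auto simp: R'_def)
    then show ?thesis
      using d inField by auto
  qed
  have Field_R': "Field R' = e ` Field R"
    by (auto simp: R'_def Field_def)
  have ed: "e (d a) = a \<and> d a \<in> Field R" if "a \<in> Field R'" for a
    using that d Field_R' by auto
  have Refl: "Refl R'"
    using R(1) Field_R' R'I by (auto simp: refl_on_def)
  have trans: "trans R'"
  proof (rule transI)
    fix a b c assume ab: "(a, b) \<in> R'" and bc: "(b, c) \<in> R'"
    then have "(d a, d c) \<in> R"
      using R'E R(2) by (meson transD)
    then have "(e (d a), e (d c)) \<in> R'"
      by (rule R'I)
    then show "(a, c) \<in> R'"
      using ed ab bc by (metis FieldI1 FieldI2)
  qed
  have diagram': "thin_diagram K R' (X \<circ> d) (\<lambda>a b. m (d a) (d b))"
    using diagram ed R'E unfolding thin_diagram_def by auto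
  have small': "small (Field R')"
    unfolding small_def Field_R' using small by (rule small_image)
  obtain c \<iota>
    where colim: "is_colimit (thin_cat R') K (thin_functor (X \<circ> d) (\<lambda>a b. m (d a) (d b))) c \<iota>"
    by (rule thin_diagram_is_colimit[OF diagram' Refl trans small'])
  have cocone: "thin_cocone K R X m c' (\<iota>' \<circ> e)"
    if "thin_cocone K R' (X \<circ> d) (\<lambda>a b. m (d a) (d b)) c' \<iota>'" for c' \<iota>'
    unfolding thin_cocone_def
  proof (intro conjI allI ballI impI)
    show "c' \<in> Ob K"
      using that by (simp add: thin_cocone_def)
  next
    fix i assume "i \<in> Field R"
    then show "(\<iota>' \<circ> e) i \<in> hom K (X i) c'"
      using that d[of i] by (auto simp: thin_cocone_def Field_R')
  next
    fix i j assume "(i, j) \<in> R"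
    then show "Comp K ((\<iota>' \<circ> e) j) (m i j) = (\<iota>' \<circ> e) i"
      using that R'I[of i j] inField[of i j] d[of i] d[of j] unfolding thin_cocone_def by fastforce
  qed
  have cocone': "thin_cocone K R' (X \<circ> d) (\<lambda>a b. m (d a) (d b)) c' (\<iota>' \<circ> d)"
    if "thin_cocone K R X m c' \<iota>'" for c' \<iota>'
    using that ed R'E unfolding thin_cocone_def by auto
  show thesis
  proof
    show "thin_cocone K R X m c (\<iota> \<circ> e)"
      using colim by (intro cocone) (auto simp: is_colimit_def is_cocone_thin_functor[OF gb])
  next
    fix c' \<iota>' assume "thin_cocone K R X m c' \<iota>'"
    then have "\<exists>u \<in> hom K c c'. \<forall>a \<in> Field R'. Comp K u (\<iota> a) = \<iota>' (d a)"
      using colim cocone'[of c' \<iota>']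
      unfolding is_colimit_def is_cocone_thin_functor[OF gb] thin_cat_simps(1)[OF gb]
      by (metis comp_apply)
    then show "\<exists>u \<in> hom K c c'. \<forall>i \<in> Field R. Comp K u ((\<iota> \<circ> e) i) = \<iota>' i"
      using d by (simp add: Field_R')
  qed
qed

end


section \<open>One step towards injectivity\<close>

definition solves :: "('o, 'm) category_data \<Rightarrow> 'm set \<Rightarrow> 'o \<Rightarrow> 'm \<Rightarrow> 'o \<Rightarrow> bool" where
  "solves K \<C> y t y' \<longleftrightarrow> (\<forall>g \<in> \<C>. \<forall>u \<in> hom K (Dom K g) y.
     \<exists>v \<in> hom K (Cod K g) y'. Comp K v g = Comp K t u)"

datatype 's wide_span = Base | Foot 's | Tip 's

context cocomplete_category
begin

text \<open>
  The spans \<open>y \<leftarrow> Dom (h s) \<rightarrow> Cod (h s)\<close> with apex \<open>Foot s\<close> are glued along their common end \<open>y\<close>,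
  which sits at \<open>Base\<close>.
\<close>

lemma weak_wide_pushout:
  fixes S :: "'s set"
  assumes y: "y \<in> Ob K" and S: "|S| <o |UNIV :: 'v set|"
    and h: "\<And>s. s \<in> S \<Longrightarrow> h s \<in> Mor K"
    and u: "\<And>s. s \<in> S \<Longrightarrow> u s \<in> hom K (Dom K (h s)) y"
  obtains y' t where "t \<in> hom K y y'"
    and "\<forall>s \<in> S. \<exists>v \<in> hom K (Cod K (h s)) y'. Comp K v (h s) = Comp K t (u s)"
    and "\<forall>z w. \<forall>f \<in> hom K y z.
      (\<forall>s \<in> S. w s \<in> hom K (Cod K (h s)) z \<and> Comp K (w s) (h s) = Comp K f (u s)) \<longrightarrow>
      (\<exists>f' \<in> hom K y' z. Comp K f' t = f)"
proof -
  define V where "V = insert Base (Foot ` S \<union> Tip ` S)"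
  define R where "R = Id_on V \<union> (\<lambda>s. (Foot s, Base)) ` S \<union> (\<lambda>s. (Foot s, Tip s)) ` S"
  define X where "X = case_wide_span y (\<lambda>s. Dom K (h s)) (\<lambda>s. Cod K (h s))"
  define m where "m i j = (if i = j then Ident K (X i) else
    case i of Foot s \<Rightarrow> (case j of Base \<Rightarrow> u s | _ \<Rightarrow> h s) | _ \<Rightarrow> undefined)" for i j
  have X: "X Base = y" "X (Foot s) = Dom K (h s)" "X (Tip s) = Cod K (h s)" for s
    by (simp_all add: X_def)
  have m: "m i i = Ident K (X i)" "m (Foot s) Base = u s" "m (Foot s) (Tip s) = h s" for i s
    by (simp_all add: m_def)
  have h': "h s \<in> hom K (Dom K (h s)) (Cod K (h s))" if "s \<in> S" for s
    using h[OF that] by (simp add: hom_def)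
  have V: "i \<in> V \<Longrightarrow> X i \<in> Ob K" for i
    using y h dom_in_Ob cod_in_Ob by (auto simp: V_def X)
  have Field_R: "Field R = V"
    by (auto simp: R_def V_def Field_def)
  have R_cases: "(i = j \<and> i \<in> V) \<or> (\<exists>s \<in> S. i = Foot s \<and> (j = Base \<or> j = Tip s))"
    if "(i, j) \<in> R" for i j
    using that by (auto simp: R_def)
  have m_hom: "m i j \<in> hom K (X i) (X j)" if "(i, j) \<in> R" for i j
    using R_cases[OF that] V ident_in_hom u h' by (auto simp: m X)
  have diagram: "thin_diagram K R X m"
    unfolding thin_diagram_def Field_R
  proof (intro conjI allI ballI impI)
    fix i j k assume ij: "(i, j) \<in> R" and jk: "(j, k) \<in> R"
    then have "i = j \<or> j = k"
      using R_cases[OF ij] R_cases[OF jk] by auto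
    then show "Comp K (m j k) (m i j) = m i k"
      using comp_ident_left[OF m_hom[OF ij]] comp_ident_right[OF m_hom[OF jk]] by (auto simp: m)
  qed (use V m m_hom in auto)
  have "|V| <o |UNIV :: 'v set|"
    using small_Un[OF gb small_finite[OF gb, of "{Base}"]
        small_Un[OF gb small_image[OF S, of Foot] small_image[OF S, of Tip]]]
    by (simp add: V_def)
  moreover have "Refl R"
    unfolding Field_R refl_on_def by (auto simp: R_def)
  moreover have "trans R"
    by (rule transI) (auto simp: R_def)
  ultimately obtain c \<iota> where c: "thin_cocone K R X m c \<iota>"
    and univ: "\<And>c' \<iota>'. thin_cocone K R X m c' \<iota>' \<Longrightarrow>
      \<exists>u \<in> hom K c c'. \<forall>i \<in> V. Comp K u (\<iota> i) = \<iota>' i"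
    using thin_diagram_colimit[OF diagram] unfolding Field_R by metis
  have R: "(Foot s, Base) \<in> R" "(Foot s, Tip s) \<in> R" if "s \<in> S" for s
    using that by (auto simp: R_def)
  have V_mem: "Base \<in> V" "s \<in> S \<Longrightarrow> Tip s \<in> V" for s
    by (auto simp: V_def)
  show thesis
  proof (intro that ballI allI impI)
    show "\<iota> Base \<in> hom K y c"
      using c V_mem(1) unfolding thin_cocone_def Field_R by (metis X(1))
  next
    fix s assume s: "s \<in> S"
    have "Comp K (\<iota> (Tip s)) (h s) = \<iota> (Foot s)" "Comp K (\<iota> Base) (u s) = \<iota> (Foot s)"
      using c R[OF s] unfolding thin_cocone_def by (metis m)+
    moreover have "\<iota> (Tip s) \<in> hom K (Cod K (h s)) c"
      using c V_mem(2)[OF s] unfolding thin_cocone_def Field_R by (metis X(3))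
    ultimately show "\<exists>v \<in> hom K (Cod K (h s)) c. Comp K v (h s) = Comp K (\<iota> Base) (u s)"
      by auto
  next
    fix z w f
    assume f: "f \<in> hom K y z" and
      w: "\<forall>s \<in> S. w s \<in> hom K (Cod K (h s)) z \<and> Comp K (w s) (h s) = Comp K f (u s)"
    define \<iota>' where "\<iota>' = case_wide_span f (\<lambda>s. Comp K f (u s)) w"
    have \<iota>': "\<iota>' Base = f" "\<iota>' (Foot s) = Comp K f (u s)" "\<iota>' (Tip s) = w s" for s
      by (simp_all add: \<iota>'_def)
    have \<iota>'_hom: "\<iota>' i \<in> hom K (X i) z" if "i \<in> V" for i
      using that f w comp_in_hom[OF u f] by (auto simp: V_def \<iota>' X)
    have "thin_cocone K R X m z \<iota>'"
      unfolding thin_cocone_def Field_R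
    proof (intro conjI allI ballI impI)
      show "z \<in> Ob K"
        using f cod_in_Ob by (auto simp: hom_def)
    next
      fix i j assume "(i, j) \<in> R"
      then show "Comp K (\<iota>' j) (m i j) = \<iota>' i"
        using R_cases[of i j] comp_ident_right[OF \<iota>'_hom[of i]] w by (auto simp: m \<iota>')
    qed (use \<iota>'_hom in auto)
    then show "\<exists>f' \<in> hom K c z. Comp K f' (\<iota> Base) = f"
      using univ V_mem(1) \<iota>'(1) by metis
  qed
qed

text \<open>A terminal object is a limit of the empty diagram.\<close>

lemma terminal_object:
  assumes "complete K"
  obtains one where "one \<in> Ob K" and "\<And>y. y \<in> Ob K \<Longrightarrow> \<exists>!f. f \<in> hom K y one"
proof -
  have "small_category (thin_cat {} :: ('v, 'v) category_data)"
    by (intro small_category_thin_cat[OF gb])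
      (auto simp: refl_on_def small_def intro!: small_finite[OF gb])
  moreover have "is_functor (thin_cat {} :: ('v, 'v) category_data) K (thin_functor undefined undefined)"
    by (intro is_functor_thin_functor[OF gb]) (auto simp: thin_diagram_def)
  ultimately obtain one \<pi>
    where "is_limit (thin_cat {} :: ('v, 'v) category_data) K (thin_functor undefined undefined) one \<pi>"
    using assms unfolding complete_def by blast
  then show thesis
    by (intro that) (auto simp: is_limit_def is_cone_def thin_cat_simps[OF gb])
qed

text \<open>
  Cone-coreflectivity is applied to the morphism from \<open>y\<close> to the terminal object: a square over it is
  determined by its upper component, so it provides a set of members of \<open>\<C>\<close> through which all extension
  problems with values in \<open>y\<close> factor. The wide pushout solves the problems for this set. A map into
  an injective object extends over it because injectivity extends it over each of the spans.
\<close>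

lemma step_into_injectives:
  assumes C: "cone_coreflective K \<C>" and complete: "complete K" and y: "y \<in> Ob K"
  obtains y' t where "t \<in> hom K y y'"
    and "solves K \<C> y t y'"
    and "\<And>z f. injective_object K \<C> z \<Longrightarrow> f \<in> hom K y z \<Longrightarrow> \<exists>f' \<in> hom K y' z. Comp K f' t = f"
proof -
  obtain one where "one \<in> Ob K" and one: "\<And>y. y \<in> Ob K \<Longrightarrow> \<exists>!f. f \<in> hom K y one"
    using terminal_object[OF complete] by metis
  obtain e where e: "e \<in> hom K y one"
    using one[OF y] by blast
  then have "e \<in> Mor K" and Dom_e: "Dom K e = y" and Cod_e: "Cod K e = one"
    by (auto simp: hom_def)
  have C_Mor: "\<C> \<subseteq> Mor K"
    using C by (simp add: cone_coreflective_def)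
  obtain H where H: "H \<subseteq> \<C>" and small_H: "small H"
    and H_factor: "\<forall>g \<in> \<C>. \<forall>s \<in> hom (arrow_cat K) g e.
      \<exists>h \<in> H. \<exists>p \<in> hom (arrow_cat K) g h. \<exists>q \<in> hom (arrow_cat K) h e. s = Comp (arrow_cat K) q p"
    using C \<open>e \<in> Mor K\<close> unfolding cone_coreflective_def by meson
  define S where "S = (SIGMA h : H. hom K (Dom K h) y)"
  have "|S| <o |UNIV :: 'v set|"
    unfolding S_def using small_H H C_Mor hom_small[OF dom_in_Ob y]
    by (intro small_Sigma[OF gb]) (auto simp: small_def)
  moreover have "fst s \<in> Mor K" "snd s \<in> hom K (Dom K (fst s)) y" if "s \<in> S" for s
    using that H C_Mor by (auto simp: S_def)
  ultimately obtain y' t where t: "t \<in> hom K y y'"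
    and sol: "\<forall>s \<in> S. \<exists>v \<in> hom K (Cod K (fst s)) y'. Comp K v (fst s) = Comp K t (snd s)"
    and univ: "\<forall>z w. \<forall>f \<in> hom K y z.
      (\<forall>s \<in> S. w s \<in> hom K (Cod K (fst s)) z \<and> Comp K (w s) (fst s) = Comp K f (snd s)) \<longrightarrow>
      (\<exists>f' \<in> hom K y' z. Comp K f' t = f)"
    by (rule weak_wide_pushout[OF y, where h = fst and u = snd])
  show thesis
  proof
    show "t \<in> hom K y y'" by (rule t)
  next
    have "\<exists>v \<in> hom K (Cod K g) y'. Comp K v g = Comp K t u"
      if g: "g \<in> \<C>" and u: "u \<in> hom K (Dom K g) y" for g u
    proof -
      have g_Mor: "g \<in> Mor K"
        using g C_Mor by auto
      then have g_hom: "g \<in> hom K (Dom K g) (Cod K g)"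
        by (simp add: hom_def)
      obtain b where b: "b \<in> hom K (Cod K g) one"
        using one[OF cod_in_Ob[OF g_Mor]] by blast
      have "Comp K b g = Comp K e u"
        using comp_in_hom[OF g_hom b] comp_in_hom[OF u e] one[OF dom_in_Ob[OF g_Mor]] by blast
      then have "(g, u, b, e) \<in> hom (arrow_cat K) g e"
        using g_Mor \<open>e \<in> Mor K\<close> u b by (simp add: hom_arrow_cat Dom_e Cod_e)
      from H_factor[rule_format, OF g this] obtain h u1 v1 u2 where h: "h \<in> H"
        and 1: "u1 \<in> hom K (Dom K g) (Dom K h)" "v1 \<in> hom K (Cod K g) (Cod K h)"
          "Comp K v1 g = Comp K h u1"
        and 2: "u2 \<in> hom K (Dom K h) y" "u = Comp K u2 u1"
        by (auto simp: hom_arrow_cat arrow_cat_simps Dom_e)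
      obtain w where w: "w \<in> hom K (Cod K h) y'" "Comp K w h = Comp K t u2"
        using sol h 2(1) by (force simp: S_def)
      have h_hom: "h \<in> hom K (Dom K h) (Cod K h)"
        using h H C_Mor by (auto simp: hom_def)
      have "Comp K (Comp K w v1) g = Comp K w (Comp K h u1)"
        using comp_assoc[OF g_hom 1(2) w(1)] 1(3) by simp
      also have "\<dots> = Comp K (Comp K t u2) u1"
        using comp_assoc[OF 1(1) h_hom w(1)] w(2) by simp
      also have "\<dots> = Comp K t u"
        using comp_assoc[OF 1(1) 2(1) t] 2(2) by simp
      finally show ?thesis
        using comp_in_hom[OF 1(2) w(1)] by blast
    qed
    then show "solves K \<C> y t y'"
      by (simp add: solves_def)
  next
    fix z f assume z: "injective_object K \<C> z" and f: "f \<in> hom K y z"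
    have "\<exists>w \<in> hom K (Cod K (fst s)) z. Comp K w (fst s) = Comp K f (snd s)" if "s \<in> S" for s
      using that z H comp_in_hom[OF _ f] unfolding injective_object_def S_def by auto
    then obtain w where "\<And>s. s \<in> S \<Longrightarrow>
        w s \<in> hom K (Cod K (fst s)) z \<and> Comp K (w s) (fst s) = Comp K f (snd s)"
      by metis
    then show "\<exists>f' \<in> hom K y' z. Comp K f' t = f"
      using univ f by blast
  qed
qed

end


section \<open>The chain of the small object argument\<close>

text \<open>
  The condition on the stage at \<open>i\<close>, an object \<open>c\<close> with transitions \<open>n j : X j \<rightarrow> c\<close>, in terms of
  the earlier stages \<open>X j\<close> and their transitions \<open>M k j : X k \<rightarrow> X j\<close>. It uses \<open>X\<close> and \<open>M\<close> only at
  indices strictly below \<open>i\<close>, as a recursive choice of the stages requires. The last clause keeps what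
  is needed of the colimit and the step that produce \<open>c\<close>: a cocone from the earlier stages to an
  injective object extends to \<open>c\<close>. It exempts the first stage, where it would ask for a map from \<open>x\<close>
  to every injective object. Indices outside the field of \<open>r\<close> count as first stages too.
\<close>

definition chain_stage ::
  "('o, 'm) category_data \<Rightarrow> 'm set \<Rightarrow> 'i rel \<Rightarrow> 'o \<Rightarrow> ('i \<Rightarrow> 'o) \<Rightarrow> ('i \<Rightarrow> 'i \<Rightarrow> 'm) \<Rightarrow>
   'i \<Rightarrow> 'o \<Rightarrow> ('i \<Rightarrow> 'm) \<Rightarrow> bool" where
  "chain_stage K \<C> r x X M i c n \<longleftrightarrow>
     c \<in> Ob K \<and> n i = Ident K c \<and>
     ((\<forall>j. (j, i) \<notin> r - Id) \<longrightarrow> c = x) \<and>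
     (\<forall>j. (j, i) \<in> r - Id \<longrightarrow>
        n j \<in> hom K (X j) c \<and> solves K \<C> (X j) (n j) c \<and>
        (\<forall>k. (k, j) \<in> r \<longrightarrow> Comp K (n j) (M k j) = n k)) \<and>
     (\<forall>z f. (\<exists>j. (j, i) \<in> r - Id) \<longrightarrow> injective_object K \<C> z \<longrightarrow>
        (\<forall>j. (j, i) \<in> r - Id \<longrightarrow> f j \<in> hom K (X j) z \<and>
          (\<forall>k. (k, j) \<in> r \<longrightarrow> Comp K (f j) (M k j) = f k)) \<longrightarrow>
        (\<exists>g \<in> hom K c z. \<forall>j. (j, i) \<in> r - Id \<longrightarrow> Comp K g (n j) = f j))"

definition small_object_chain ::
  "('o, 'm) category_data \<Rightarrow> 'm set \<Rightarrow> 'i rel \<Rightarrow> 'o \<Rightarrow> ('i \<Rightarrow> 'o) \<Rightarrow> ('i \<Rightarrow> 'i \<Rightarrow> 'm) \<Rightarrow> bool" where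
  "small_object_chain K \<C> r x X M \<longleftrightarrow> (\<forall>i. chain_stage K \<C> r x X M i (X i) (\<lambda>j. M j i))"

context cocomplete_category
begin

lemma chain_stage_transition:
  assumes "chain_stage K \<C> r x X M i (X i) (\<lambda>j. M j i)" and "(j, i) \<in> r"
  shows "M j i \<in> hom K (X j) (X i)"
  using assms ident_in_hom by (cases "j = i") (auto simp: chain_stage_def)

lemma chain_stage_comp:
  assumes "chain_stage K \<C> r x X M i (X i) (\<lambda>j. M j i)"
    and "(j, i) \<in> r" "(k, j) \<in> r" and "M k j \<in> hom K (X k) (X j)"
  shows "Comp K (M j i) (M k j) = M k i"
  using assms comp_ident_left by (cases "j = i") (auto simp: chain_stage_def)

text \<open>
  The new stage is the step applied to the colimit \<open>y\<close> of the stages below \<open>i\<close>. Problems posed at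
  an earlier stage become problems in \<open>y\<close>, where the step solves them; a cocone to an injective
  object factors through \<open>y\<close> and then extends along the step.
\<close>

lemma chain_stage_exists:
  fixes r :: "'v rel"
  assumes C: "cone_coreflective K \<C>" and complete: "complete K"
    and r: "Well_order r" and small_r: "small (Field r)" and x: "x \<in> Ob K"
    and IH: "\<And>j. (j, i) \<in> r - Id \<Longrightarrow> chain_stage K \<C> r x X M j (X j) (\<lambda>k. M k j)"
  obtains c n where "chain_stage K \<C> r x X M i c n"
proof (cases "\<exists>j. (j, i) \<in> r - Id")
  case False
  then have "chain_stage K \<C> r x X M i x (\<lambda>_. Ident K x)"
    using x unfolding chain_stage_def by blast
  then show ?thesis
    by (rule that)
next
  case True
  have Refl: "Refl r" and trans: "trans r" and antisym: "antisym r"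
    using r by (auto simp: order_on_defs)
  define A where "A = {j. (j, i) \<in> r - Id}"
  define R where "R = Restr r A"
  have A: "j \<in> A \<longleftrightarrow> (j, i) \<in> r - Id" for j
    by (simp add: A_def)
  (* A is an initial segment, so that R is again a preorder with field A. *)
  have A_down: "k \<in> A" if "j \<in> A" "(k, j) \<in> r" for j k
  proof -
    have "(k, i) \<in> r" "k \<noteq> i"
      using that transD[OF trans] antisymD[OF antisym] unfolding A by auto
    then show ?thesis
      by (simp add: A)
  qed
  have refl: "(j, j) \<in> r" if "j \<in> A" for j
    using that Refl unfolding A refl_on_def by (auto dest: FieldI1)
  have R: "(j, k) \<in> R \<longleftrightarrow> (j, k) \<in> r \<and> k \<in> A" for j k
    using A_down unfolding R_def by auto
  have Field_R: "Field R = A"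
    using refl by (auto simp: R_def Field_def)
  have stage: "chain_stage K \<C> r x X M j (X j) (\<lambda>k. M k j)" if "j \<in> A" for j
    using IH that unfolding A by blast
  have X: "X j \<in> Ob K" "M j j = Ident K (X j)" if "j \<in> A" for j
    using stage[OF that] unfolding chain_stage_def by auto
  note M = chain_stage_transition[OF stage]
  have M_comp: "Comp K (M j l) (M k j) = M k l" if "l \<in> A" "(j, l) \<in> r" "(k, j) \<in> r" for j k l
    using chain_stage_comp[OF stage[OF that(1)] that(2,3) M[OF A_down[OF that(1,2)] that(3)]] .
  have diagram: "thin_diagram K R X M"
    using X M M_comp unfolding thin_diagram_def R Field_R by blast
  have Refl_R: "Refl R"
    using refl unfolding refl_on_def Field_R R by blast
  have trans_R: "trans R"
  proof (rule transI)
    fix j k l assume "(j, k) \<in> R" "(k, l) \<in> R"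
    then show "(j, l) \<in> R"
      unfolding R using transD[OF trans] by blast
  qed
  have small_R: "|Field R| <o |UNIV :: 'v set|"
    using small_r unfolding small_def
    by (rule small_subset) (auto simp: Field_R A dest: FieldI1)
  obtain y \<iota> where y: "thin_cocone K R X M y \<iota>"
    and univ: "\<And>c' \<iota>'. thin_cocone K R X M c' \<iota>' \<Longrightarrow>
      \<exists>u \<in> hom K y c'. \<forall>j \<in> A. Comp K u (\<iota> j) = \<iota>' j"
    using thin_diagram_colimit[OF diagram Refl_R trans_R small_R, unfolded Field_R] by metis
  have \<iota>: "\<iota> j \<in> hom K (X j) y" if "j \<in> A" for j
    using y that unfolding thin_cocone_def Field_R by auto
  have \<iota>_comp: "Comp K (\<iota> j) (M k j) = \<iota> k" if "j \<in> A" "(k, j) \<in> r" for j k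
    using y that unfolding thin_cocone_def R by auto
  have "y \<in> Ob K"
    using y by (simp add: thin_cocone_def)
  then obtain c t where t: "t \<in> hom K y c" and t_solves: "solves K \<C> y t c"
    and t_extends: "\<And>z f. injective_object K \<C> z \<Longrightarrow> f \<in> hom K y z \<Longrightarrow>
      \<exists>f' \<in> hom K c z. Comp K f' t = f"
    using step_into_injectives[OF C complete] by metis
  define n where "n j = (if j = i then Ident K c else Comp K t (\<iota> j))" for j
  have n: "n j = Comp K t (\<iota> j)" if "j \<in> A" for j
    using that by (auto simp: n_def A)
  have "solves K \<C> (X j) (n j) c" if j: "j \<in> A" for j
    unfolding solves_def
  proof (intro ballI)
    fix g u assume g: "g \<in> \<C>" and u: "u \<in> hom K (Dom K g) (X j)"
    have "\<exists>v \<in> hom K (Cod K g) c. Comp K v g = Comp K t (Comp K (\<iota> j) u)"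
      using t_solves g comp_in_hom[OF u \<iota>[OF j]] unfolding solves_def by blast
    then show "\<exists>v \<in> hom K (Cod K g) c. Comp K v g = Comp K (n j) u"
      using comp_assoc[OF u \<iota>[OF j] t] n[OF j] by simp
  qed
  moreover have "n j \<in> hom K (X j) c" if "j \<in> A" for j
    using comp_in_hom[OF \<iota>[OF that] t] n[OF that] by simp
  moreover have "Comp K (n j) (M k j) = n k" if j: "j \<in> A" and kj: "(k, j) \<in> r" for j k
    using comp_assoc[OF M[OF j kj] \<iota>[OF j] t] \<iota>_comp[OF j kj] n[OF j] n[OF A_down[OF j kj]]
    by simp
  moreover have "\<exists>g \<in> hom K c z. \<forall>j. j \<in> A \<longrightarrow> Comp K g (n j) = f j"
    if z: "injective_object K \<C> z" and f: "\<forall>j. j \<in> A \<longrightarrow> f j \<in> hom K (X j) z \<and>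
      (\<forall>k. (k, j) \<in> r \<longrightarrow> Comp K (f j) (M k j) = f k)" for z f
  proof -
    have "thin_cocone K R X M z f"
      using f z unfolding thin_cocone_def R Field_R injective_object_def by auto
    then obtain u where u: "u \<in> hom K y z" "\<forall>j \<in> A. Comp K u (\<iota> j) = f j"
      using univ by blast
    obtain g where g: "g \<in> hom K c z" "Comp K g t = u"
      using t_extends[OF z u(1)] by blast
    have "Comp K g (n j) = f j" if "j \<in> A" for j
      using comp_assoc[OF \<iota>[OF that] t g(1)] n[OF that] u(2) g(2) that by simp
    then show ?thesis
      using g(1) by blast
  qed
  moreover have "c \<in> Ob K"
    using t cod_in_Ob by (auto simp: hom_def)
  moreover have "n i = Ident K c"
    by (simp add: n_def)
  ultimately have "chain_stage K \<C> r x X M i c n"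
    unfolding chain_stage_def using True unfolding A[symmetric] by blast
  then show ?thesis
    by (rule that)
qed

text \<open>
  The object at \<open>i\<close> and all transitions into it are chosen together, as one value of the recursion.
\<close>

lemma small_object_chain_exists:
  fixes r :: "'v rel"
  assumes C: "cone_coreflective K \<C>" and complete: "complete K"
    and r: "Well_order r" and small_r: "small (Field r)" and x: "x \<in> Ob K"
  obtains X M where "small_object_chain K \<C> r x X M"
proof -
  have wf: "wf (r - Id)"
    using r by (auto simp: order_on_defs)
  define good where "good F i s \<longleftrightarrow>
      chain_stage K \<C> r x (\<lambda>j. fst (F j)) (\<lambda>k j. snd (F j) k) i (fst s) (snd s)"
    for F :: "'v \<Rightarrow> 'v \<times> ('v \<Rightarrow> 'v)" and i s
  have "\<exists>F. \<forall>i. good F i (F i)"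
  proof (rule dependent_wf_choice[OF wf])
    fix F G :: "'v \<Rightarrow> 'v \<times> ('v \<Rightarrow> 'v)" and i s
    assume eq: "\<And>j. (j, i) \<in> r - Id \<Longrightarrow> F j = G j"
    show "good F i s = good G i s"
      unfolding good_def chain_stage_def using eq by (simp cong: conj_cong imp_cong)
  next
    fix i F assume IH: "\<And>j. (j, i) \<in> r - Id \<Longrightarrow> good F j (F j)"
    obtain c n where "chain_stage K \<C> r x (\<lambda>j. fst (F j)) (\<lambda>k j. snd (F j) k) i c n"
      using chain_stage_exists[OF C complete r small_r x] IH unfolding good_def by blast
    then show "\<exists>s. good F i s"
      unfolding good_def by (metis fst_conv snd_conv)
  qed
  then show thesis
    using that unfolding small_object_chain_def good_def by blast
qed

lemma thin_diagram_small_object_chain: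
  assumes "small_object_chain K \<C> r x X M"
  shows "thin_diagram K r X M"
  unfolding thin_diagram_def
proof (intro conjI allI ballI impI)
  have stage: "chain_stage K \<C> r x X M i (X i) (\<lambda>j. M j i)" for i
    using assms by (simp add: small_object_chain_def)
  note M = chain_stage_transition[OF stage]
  show "X i \<in> Ob K" "M i i = Ident K (X i)" for i
    using stage[of i] by (auto simp: chain_stage_def)
  show "M i j \<in> hom K (X i) (X j)" if "(i, j) \<in> r" for i j
    by (rule M[OF that])
  show "Comp K (M j k) (M i j) = M i k" if "(i, j) \<in> r" "(j, k) \<in> r" for i j k
    by (rule chain_stage_comp[OF stage that(2,1) M[OF that(1)]])
qed

text \<open>
  The extensions to the stages are not unique, so they have to be chosen by recursion as well: those
  already chosen form a cocone from the earlier stages, which extends to the next one.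
\<close>

lemma extension_along_chain:
  fixes r :: "'v rel"
  assumes r: "Well_order r" and chain: "small_object_chain K \<C> r x X M"
    and z: "injective_object K \<C> z" and f: "f \<in> hom K x z"
  obtains e where "thin_cocone K r X M z e" and "\<And>i. (\<And>j. (j, i) \<notin> r - Id) \<Longrightarrow> e i = f"
proof -
  have wf: "wf (r - Id)"
    using r by (auto simp: order_on_defs)
  have stage: "chain_stage K \<C> r x X M i (X i) (\<lambda>j. M j i)" for i
    using chain by (simp add: small_object_chain_def)
  define good where "good e i g \<longleftrightarrow> g \<in> hom K (X i) z \<and> ((\<forall>j. (j, i) \<notin> r - Id) \<longrightarrow> g = f) \<and>
    (\<forall>j. (j, i) \<in> r - Id \<longrightarrow> Comp K g (M j i) = e j)" for e i g
  have comp: "Comp K (e j) (M k j) = e k" if "good e j (e j)" "(k, j) \<in> r" for e j k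
  proof (cases "k = j")
    case True
    moreover have "M j j = Ident K (X j)"
      using stage[of j] by (auto simp: chain_stage_def)
    ultimately show ?thesis
      using comp_ident_right that(1) by (auto simp: good_def)
  qed (use that in \<open>auto simp: good_def\<close>)
  have "\<exists>e. \<forall>i. good e i (e i)"
  proof (rule dependent_wf_choice[OF wf])
    fix e e' :: "'v \<Rightarrow> 'v" and i g assume "\<And>j. (j, i) \<in> r - Id \<Longrightarrow> e j = e' j"
    then show "good e i g = good e' i g"
      unfolding good_def by simp
  next
    fix i e assume IH: "\<And>j. (j, i) \<in> r - Id \<Longrightarrow> good e j (e j)"
    show "\<exists>g. good e i g"
    proof (cases "\<exists>j. (j, i) \<in> r - Id")
      case False
      then show ?thesis
        using stage[of i] f by (auto simp: good_def chain_stage_def)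
    next
      case True
      have "e j \<in> hom K (X j) z \<and> (\<forall>k. (k, j) \<in> r \<longrightarrow> Comp K (e j) (M k j) = e k)"
        if "(j, i) \<in> r - Id" for j
        using IH[OF that] comp[OF IH[OF that]] by (simp add: good_def)
      then have "\<exists>g \<in> hom K (X i) z. \<forall>j. (j, i) \<in> r - Id \<longrightarrow> Comp K g (M j i) = e j"
        using stage[of i] True z unfolding chain_stage_def by blast
      then show ?thesis
        using True unfolding good_def by blast
    qed
  qed
  then obtain e where e: "\<And>i. good e i (e i)"
    by blast
  show thesis
  proof
    have "z \<in> Ob K"
      using z by (simp add: injective_object_def)
    then show "thin_cocone K r X M z e"
      using e comp[OF e] unfolding thin_cocone_def good_def by blast
    show "e i = f" if "\<And>j. (j, i) \<notin> r - Id" for i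
      using e[of i] that by (simp add: good_def)
  qed
qed

end


section \<open>Presentable objects and filtered colimits\<close>

lemma hom_set_cat:
  "(A', f, B') \<in> hom set_cat A B \<longleftrightarrow> A' = A \<and> B' = B \<and> small A \<and> small B \<and> f \<in> A \<rightarrow>\<^sub>E B"
  unfolding hom_def by (auto simp: set_cat_def)

context cocomplete_category
begin

text \<open>
  The maps \<open>hom(a, D j) \<rightarrow> hom(a, c)\<close> form a colimit cocone of sets, and such a cocone is jointly
  surjective: the characteristic function of the union \<open>U\<close> of the images and the constant function
  agree on all images, so they are equal by uniqueness of the mediating function.
\<close>

lemma presentable_factors_through_stage:
  fixes J :: "('v, 'v) category_data"
  assumes a: "presentable \<mu> K a"
    and J: "small_category J" "filtered \<mu> J" and D: "is_functor J K D"
    and c: "is_colimit J K D c \<iota>" and u: "u \<in> hom K a c"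
  obtains j u' where "j \<in> Ob J" and "u' \<in> hom K a (OMap D j)" and "u = Comp K (\<iota> j) u'"
proof -
  define H where "H = hom_functor K a"
  have a_Ob: "a \<in> Ob K"
    using a by (simp add: presentable_def)
  have cocone: "is_cocone J K D c \<iota>"
    using c by (simp add: is_colimit_def)
  have colim: "is_colimit J set_cat (functor_comp H D) (OMap H c) (\<lambda>j. MMap H (\<iota> j))"
    using a J D c unfolding presentable_def preserves_filtered_colimits_def H_def by blast
  obtain p q :: 'v where pq: "p \<noteq> q"
    using ex_new_if_finite[OF gb_Cinfinite(3)[OF gb], of "{undefined}"] by auto
  (* B is a two-element set of truth values, with p for true. *)
  define B where "B = {p, q}"
  have small_B: "small B"
    unfolding small_def B_def by (rule small_finite[OF gb]) simp
  have c_Ob: "c \<in> Ob K"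
    using cocone by (simp add: is_cocone_def)
  have \<iota>: "\<iota> j \<in> hom K (OMap D j) c" if "j \<in> Ob J" for j
    using cocone that by (simp add: is_cocone_def)
  have D_Ob: "OMap D j \<in> Ob K" if "j \<in> Ob J" for j
    using D that by (simp add: is_functor_def)
  define U where "U = (\<Union>j \<in> Ob J. Comp K (\<iota> j) ` hom K a (OMap D j))"
  define k where "k j = (hom K a (OMap D j), \<lambda>g \<in> hom K a (OMap D j). p, B)" for j
  have "is_cocone J set_cat (functor_comp H D) B k"
    unfolding is_cocone_def
  proof (intro conjI ballI)
    show "B \<in> Ob set_cat"
      using small_B by (simp add: set_cat_def)
    show "k j \<in> hom set_cat (OMap (functor_comp H D) j) B" if "j \<in> Ob J" for j
      using small_B hom_small[OF a_Ob D_Ob[OF that]]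
      by (auto simp: k_def hom_set_cat functor_comp_def H_def hom_functor_def B_def)
    show "Comp set_cat (k (Cod J f)) (MMap (functor_comp H D) f) = k (Dom J f)" if "f \<in> Mor J" for f
    proof -
      have "MMap D f \<in> hom K (OMap D (Dom J f)) (OMap D (Cod J f))"
        using D that by (simp add: is_functor_def)
      then show ?thesis
        using comp_in_hom[of _ a "OMap D (Dom J f)" "MMap D f" "OMap D (Cod J f)"]
        by (auto simp: k_def set_cat_def functor_comp_def H_def hom_functor_def compose_def
            fun_eq_iff hom_def[of K "OMap D (Dom J f)"])
    qed
  qed
  then have unique: "\<And>v w. \<lbrakk>v \<in> hom set_cat (OMap H c) B; w \<in> hom set_cat (OMap H c) B;
      \<forall>j \<in> Ob J. Comp set_cat v (MMap H (\<iota> j)) = k j;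
      \<forall>j \<in> Ob J. Comp set_cat w (MMap H (\<iota> j)) = k j\<rbrakk> \<Longrightarrow> v = w"
    using colim unfolding is_colimit_def by metis
  define \<chi> where "\<chi> V = (hom K a c, \<lambda>g \<in> hom K a c. if g \<in> V then p else q, B)" for V
  have \<chi>_hom: "\<chi> V \<in> hom set_cat (OMap H c) B" for V
    using small_B hom_small[OF a_Ob c_Ob]
    by (auto simp: \<chi>_def hom_set_cat H_def hom_functor_def B_def)
  have \<chi>_comp: "Comp set_cat (\<chi> V) (MMap H (\<iota> j)) = k j" if "U \<subseteq> V" "j \<in> Ob J" for V j
  proof -
    have "Comp K (\<iota> j) g \<in> V \<inter> hom K a c" if "g \<in> hom K a (OMap D j)" for g
      using that \<open>U \<subseteq> V\<close> \<open>j \<in> Ob J\<close> comp_in_hom[OF that \<iota>[OF \<open>j \<in> Ob J\<close>]] by (auto simp: U_def)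
    then show ?thesis
      using \<iota>[OF that(2)]
      by (auto simp: \<chi>_def k_def set_cat_def H_def hom_functor_def compose_def fun_eq_iff
          hom_def[of K "OMap D j"])
  qed
  have "\<chi> U = \<chi> UNIV"
    using \<chi>_hom \<chi>_comp by (intro unique) auto
  then have "u \<in> U"
    using u pq by (auto simp: \<chi>_def fun_eq_iff restrict_def split: if_splits)
  then show thesis
    using that by (auto simp: U_def)
qed

text \<open>
  Fewer than \<open>r\<close> elements of \<open>Field r\<close> are not cofinal by regularity, so they have an upper bound;
  commutativity of the cocone is automatic because parallel morphisms are equal.
\<close>

lemma filtered_thin_cat:
  fixes r :: "'v rel"
  assumes "regular_cardinal r"
  shows "filtered r (thin_cat r)"
  unfolding filtered_def
proof (intro conjI allI impI)
  have Card: "Card_order r" and reg: "regularCard r"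
    using assms by (auto simp: regular_cardinal_def)
  then have Well: "Well_order r"
    by (simp add: card_order_on_well_order_on)
  then have Refl: "Refl r" and trans: "trans r" and total: "Total r"
    by (auto simp: order_on_defs)
  show "category (thin_cat r)"
    by (rule category_thin_cat[OF gb Refl trans])
  fix I :: "('v, 'v) category_data" and D
  assume ID: "category I \<and> |Mor I| <o r \<and> is_functor I (thin_cat r) D"
  then have I: "category I" and D: "is_functor I (thin_cat r) D"
    by auto
  (* A category has at most as many objects as morphisms, because of the identities. *)
  have "Ob I \<subseteq> Dom I ` Mor I"
    using category.ident_in_hom[OF I] by (force simp: hom_def)
  then have "|Ob I| <o r"
    using ID small_image small_subset by blast
  then have "|OMap D ` Ob I| <o r"
    by (rule small_image)
  moreover have D_Ob: "OMap D ` Ob I \<subseteq> Field r"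
    using D by (auto simp: is_functor_def thin_cat_simps[OF gb])
  ultimately have "\<not> cofinal (OMap D ` Ob I) r"
    using reg not_ordLess_ordIso unfolding regularCard_def by blast
  then obtain b where b: "b \<in> Field r"
    and not_above: "\<And>j. j \<in> Ob I \<Longrightarrow> \<not> (b \<noteq> OMap D j \<and> (b, OMap D j) \<in> r)"
    unfolding cofinal_def by blast
  have above: "(OMap D j, b) \<in> r" if "j \<in> Ob I" for j
  proof -
    have "OMap D j \<in> Field r"
      using that D_Ob by blast
    then show ?thesis
      using not_above[OF that] refl_onD[OF Refl b] total b unfolding total_on_def by metis
  qed
  have "is_cocone I (thin_cat r) D b (\<lambda>j. pair_code (OMap D j, b))"
    unfolding is_cocone_def
  proof (intro conjI ballI)
    fix f assume "f \<in> Mor I"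
    then have "MMap D f = pair_code (OMap D (Dom I f), OMap D (Cod I f))"
      using D by (simp add: is_functor_def thin_cat_simps[OF gb])
    then show "Comp (thin_cat r) (pair_code (OMap D (Cod I f), b)) (MMap D f)
        = pair_code (OMap D (Dom I f), b)"
      by (simp add: thin_cat_simps[OF gb])
  qed (use b above in \<open>auto simp: thin_cat_simps[OF gb]\<close>)
  then show "\<exists>c \<iota>. is_cocone I (thin_cat r) D c \<iota>"
    by blast
qed

end


section \<open>Weak reflectivity and closure under filtered colimits\<close>

context cocomplete_category
begin

text \<open>
  The weak reflection is the injection of the first stage into the colimit of the chain over \<open>r\<close>. For
  injectivity of the colimit it matters that an infinite cardinal has no greatest element: a problem
  that lives at stage \<open>i\<close> is solved at any later stage.
\<close>

lemma weakly_reflective_Inj: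
  assumes complete: "complete K" and r: "regular_cardinal r"
    and pres: "\<And>g. g \<in> \<C> \<Longrightarrow> presentable r K (Dom K g)"
    and C: "cone_coreflective K \<C>"
  shows "weakly_reflective K (Inj K \<C>)"
  unfolding weakly_reflective_def
proof
  fix x assume x: "x \<in> Ob K"
  have Card: "Card_order r" and infinite_r: "infinite (Field r)" and r_small: "r <o |UNIV :: 'v set|"
    using r by (auto simp: regular_cardinal_def cinfinite_def)
  then have Well: "Well_order r"
    by (simp add: card_order_on_well_order_on)
  then have Refl: "Refl r" and trans: "trans r" and wf: "wf (r - Id)"
    by (auto simp: order_on_defs)
  have small_r: "small (Field r)"
    using card_of_Field_ordIso[OF Card] r_small ordIso_ordLess_trans unfolding small_def by blast
  obtain X M where soc: "small_object_chain K \<C> r x X M"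
    by (rule small_object_chain_exists[OF C complete Well small_r x])
  then have stage: "chain_stage K \<C> r x X M i (X i) (\<lambda>j. M j i)" for i
    by (simp add: small_object_chain_def)
  note chain = thin_diagram_small_object_chain[OF soc]
  obtain c \<iota> where colim: "is_colimit (thin_cat r) K (thin_functor X M) c \<iota>"
    using thin_diagram_is_colimit[OF chain Refl trans small_r] by blast
  then have cocone: "thin_cocone K r X M c \<iota>"
    by (simp add: is_colimit_def is_cocone_thin_functor[OF gb])
  then have c: "c \<in> Ob K" and \<iota>: "\<And>i. i \<in> Field r \<Longrightarrow> \<iota> i \<in> hom K (X i) c"
    and \<iota>_comp: "\<And>i j. (i, j) \<in> r \<Longrightarrow> Comp K (\<iota> j) (M i j) = \<iota> i"
    by (auto simp: thin_cocone_def)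
  have "injective_object K \<C> c"
    unfolding injective_object_def
  proof (intro conjI ballI)
    fix g u assume g: "g \<in> \<C>" and u: "u \<in> hom K (Dom K g) c"
    have g_hom: "g \<in> hom K (Dom K g) (Cod K g)"
      using g C by (auto simp: cone_coreflective_def hom_def)
    obtain i u' where i: "i \<in> Field r" and u': "u' \<in> hom K (Dom K g) (X i)" "u = Comp K (\<iota> i) u'"
      using presentable_factors_through_stage[OF pres[OF g] small_category_thin_cat[OF gb Refl trans small_r]
          filtered_thin_cat[OF r] is_functor_thin_functor[OF gb chain] colim u]
      by (auto simp: thin_cat_simps[OF gb] thin_functor_simps[OF gb])
    obtain j where ij: "(i, j) \<in> r - Id" and j: "j \<in> Field r"
      using infinite_Card_order_limit[OF Card infinite_r i] by auto
    obtain v where v: "v \<in> hom K (Cod K g) (X j)" "Comp K v g = Comp K (M i j) u'"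
      using stage[of j] ij g u'(1) unfolding chain_stage_def solves_def by blast
    have M: "M i j \<in> hom K (X i) (X j)"
      using chain ij by (auto simp: thin_diagram_def)
    have "Comp K (Comp K (\<iota> j) v) g = Comp K (\<iota> j) (Comp K (M i j) u')"
      using comp_assoc[OF g_hom v(1) \<iota>[OF j]] v(2) by simp
    also have "\<dots> = u"
      using comp_assoc[OF u'(1) M \<iota>[OF j]] \<iota>_comp[of i j] ij u'(2) by simp
    finally show "\<exists>v \<in> hom K (Cod K g) c. Comp K v g = u"
      using comp_in_hom[OF v(1) \<iota>[OF j]] by blast
  qed (rule c)
  then have c_Inj: "c \<in> Ob (Inj K \<C>)"
    using c by (simp add: Inj_def full_subcategory_def)
  obtain i0 where i0: "i0 \<in> Field r" and least: "\<And>j. (j, i0) \<notin> r - Id"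
  proof -
    obtain a where "a \<in> Field r"
      using infinite_r by (metis finite.emptyI ex_in_conv)
    then obtain i0 where "i0 \<in> Field r" "\<And>j. (j, i0) \<in> r - Id \<Longrightarrow> j \<notin> Field r"
      using wfE_min[OF wf] by metis
    then show thesis
      using that by (auto dest: FieldI1)
  qed
  have \<iota>0: "\<iota> i0 \<in> hom K x c"
    using \<iota>[OF i0] stage[of i0] least by (auto simp: chain_stage_def)
  have "\<exists>g \<in> hom K c z. f = Comp K g (\<iota> i0)"
    if z: "z \<in> Ob (Inj K \<C>)" and f: "f \<in> hom K x z" for z f
  proof -
    have "injective_object K \<C> z"
      using z by (simp add: Inj_def full_subcategory_def)
    then obtain e where e: "thin_cocone K r X M z e" "e i0 = f"
      using extension_along_chain[OF Well soc _ f] least by metis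
    then obtain g where "g \<in> hom K c z" "\<forall>i \<in> Field r. Comp K g (\<iota> i) = e i"
      using colim unfolding is_colimit_def is_cocone_thin_functor[OF gb] thin_cat_simps(1)[OF gb]
      by metis
    then show ?thesis
      using i0 e(2) by metis
  qed
  then show "\<exists>x' \<in> Ob (Inj K \<C>). \<exists>r \<in> hom K x x'.
      \<forall>y \<in> Ob (Inj K \<C>). \<forall>f \<in> hom K x y. \<exists>g \<in> hom K x' y. f = Comp K g r"
    using c_Inj \<iota>0 by blast
qed

lemma closed_under_filtered_colimits_Inj:
  assumes pres: "\<And>g. g \<in> \<C> \<Longrightarrow> g \<in> Mor K \<and> presentable \<mu> K (Dom K g)"
  shows "closed_under_filtered_colimits \<mu> K (Inj K \<C>)"
  unfolding closed_under_filtered_colimits_def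
proof (intro allI impI, elim conjE)
  fix J :: "('v, 'v) category_data" and D c \<iota>
  assume J: "small_category J" "filtered \<mu> J" and D: "is_functor J (Inj K \<C>) D"
    and colim: "is_colimit J K D c \<iota>"
  have D_inj: "injective_object K \<C> (OMap D j)" if "j \<in> Ob J" for j
    using D that by (auto simp: is_functor_def Inj_def full_subcategory_def)
  have D_K: "is_functor J K D"
    using D by (auto simp: is_functor_def Inj_def full_subcategory_def hom_def)
  have c: "c \<in> Ob K" and \<iota>: "\<And>j. j \<in> Ob J \<Longrightarrow> \<iota> j \<in> hom K (OMap D j) c"
    using colim by (auto simp: is_colimit_def is_cocone_def)
  have "injective_object K \<C> c"
    unfolding injective_object_def
  proof (intro conjI ballI)
    fix g u assume g: "g \<in> \<C>" and u: "u \<in> hom K (Dom K g) c"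
    have g_hom: "g \<in> hom K (Dom K g) (Cod K g)"
      using pres[OF g] by (simp add: hom_def)
    obtain j u' where j: "j \<in> Ob J" and u': "u' \<in> hom K (Dom K g) (OMap D j)" "u = Comp K (\<iota> j) u'"
      using presentable_factors_through_stage[OF _ J D_K colim u] pres[OF g] by blast
    obtain v where v: "v \<in> hom K (Cod K g) (OMap D j)" "Comp K v g = u'"
      using D_inj[OF j] g u'(1) unfolding injective_object_def by blast
    show "\<exists>v \<in> hom K (Cod K g) c. Comp K v g = u"
      using comp_assoc[OF g_hom v(1) \<iota>[OF j]] v(2) u'(2) comp_in_hom[OF v(1) \<iota>[OF j]] by auto
  qed (rule c)
  then show "c \<in> Ob (Inj K \<C>)"
    using c by (simp add: Inj_def full_subcategory_def)
qed

end

theorem corollary4p4: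
  fixes K :: "('v, 'v) category_data" and \<kappa> :: "'v rel" and \<C> :: "'v set"
  assumes "gb_universe TYPE('v)"
    and "class_locally_presentable K"
    and "regular_cardinal \<kappa>"
    and "\<forall>f \<in> \<C>. presentable_morphism \<kappa> K f"
    and "cone_coreflective K \<C>"
  shows "weakly_reflective K (Inj K \<C>) \<and> closed_under_filtered_colimits \<kappa> K (Inj K \<C>)"
proof -
  interpret cocomplete_category K
    using assms(1,2)
    by (auto simp: class_locally_presentable_def cocomplete_category_def cocomplete_category_axioms_def)
  have "complete K"
    using assms(2) by (simp add: class_locally_presentable_def)
  then show ?thesis
    using weakly_reflective_Inj[OF _ assms(3) _ assms(5)] closed_under_filtered_colimits_Inj[of \<C> \<kappa>]
      assms(4) by (auto simp: presentable_morphism_def)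
qed

end
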